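(* Let $n,N\ge 1$ be integers, let $\omega_1,\dots,\omega_N>0$, $\rho=2\max_{1\le i\le N}\omega_i$, $0<\mu<1/\rho$, and $x_1,\dots,x_N\in\mathbb{R}^n$. For every $i\in\{1,\dots,N\}$ put $\mu_i=\mu\omega_i$ and $\alpha_i=\omega_i\|x_i\|^2$, and assume $\alpha_i>0$ for all $i\in\{1,\dots,N\}$. Let $\ell_1,\dots,\ell_N$ be an enumeration of $\{1,\dots,N\}$ such that $\alpha_{\ell_1}\ge\cdots\ge\alpha_{\ell_N}$. Let $I_0:=\emptyset$ and $I_i:=\{\ell_1,\dots,\ell_i\}$ for all $i\in\{1,\dots,N\}$. Define $$k:=\min\left\{i\in\{0,\dots,N-1\} : \Big(\sum_{j\notin I_i}\frac{1}{\mu_j}-2\Big)\sqrt{\alpha_{\ell_{i+1}}}<\sum_{j\notin I_i}\frac{\sqrt{\alpha_j}}{\mu_j}\right\}.$$ Then $\overline{p}\in\mathbb{R}^N$ defined by $$(\forall i\in\{1,\dots,N\})\quad \overline{p}_i=\begin{cases}0, & \text{if } i\in I_k;\\[4pt] \dfrac{1}{2\mu_i}\left[1-\dfrac{\big(\sum_{j\notin I_k}\frac{1}{\mu_j}-2\big)\sqrt{\alpha_i}}{\sum_{j\notin I_k}\frac{\sqrt{\alpha_j}}{\mu_j}}\right], & \text{if } i\notin I_k\end{cases}$$ is the (unique) solution to the problem $$\max_{p\in\Delta_N}\ \sum_{i=1}^{N}\frac{\alpha_i p_i}{2\mu_i p_i-1}.$$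
   Context: $\|\cdot\|$ is the Euclidean norm. $\Delta_N=\{p\in\mathbb{R}^N : p_i\ge 0 \text{ for all } i,\ \sum_{i=1}^N p_i=1\}$ is the probability simplex. Sums over $j\notin I_i$ are over $j\in\{1,\dots,N\}\setminus I_i$. *)

theory Defs
  imports "HOL-Analysis.Analysis"
begin

text \<open>Vectors in \<open>\<real>\<^sup>N\<close> are indexed by a finite type \<open>'N\<close>, which plays the role of
  \<open>{1, \<dots>, N}\<close>, so \<open>N = CARD('N) \<ge> 1\<close>.\<close>

definition prob_simplex :: "(real ^ 'N::finite) set"
  where "prob_simplex = {p. (\<forall>i. 0 \<le> p $ i) \<and> (\<Sum>i\<in>UNIV. p $ i) = 1}"

text \<open>\<open>first_indices ell i\<close> is \<open>I\<^sub>i\<close>; the enumeration \<open>ell\<close> is used only on \<open>{1..CARD('N)}\<close>.\<close>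

definition first_indices :: "(nat \<Rightarrow> 'N) \<Rightarrow> nat \<Rightarrow> 'N set"
  where "first_indices ell i = ell ` {1..i}"

text \<open>The set whose minimum is the threshold \<open>k\<close>; its third argument is the family
  \<open>(\<mu>\<^sub>i)\<close>, not the scalar \<open>\<mu>\<close>.\<close>

definition threshold_set ::
    "(nat \<Rightarrow> 'N::finite) \<Rightarrow> ('N \<Rightarrow> real) \<Rightarrow> ('N \<Rightarrow> real) \<Rightarrow> nat set"
  where "threshold_set ell \<alpha> m =
    {i \<in> {0..CARD('N) - 1}.
      ((\<Sum>j\<in>- first_indices ell i. 1 / m j) - 2) * sqrt (\<alpha> (ell (i + 1)))
        < (\<Sum>j\<in>- first_indices ell i. sqrt (\<alpha> j) / m j)}"

end

theory Submission
  imports Defs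
begin

text \<open>On the simplex each summand is strictly concave with derivative
  \<open>- \<alpha>\<^sub>i / (1 - 2 \<mu>\<^sub>i p\<^sub>i)\<^sup>2\<close>, so the first-order (KKT) conditions single out the unique maximizer:
  \<open>\<alpha>\<^sub>i / (1 - 2 \<mu>\<^sub>i p\<^sub>i)\<^sup>2\<close> equals a common value \<open>s\<^sup>2\<close> on the support and is at least \<open>s\<^sup>2\<close> off it.
  Solving for \<open>p\<^sub>i\<close> with support the complement of \<open>I\<^sub>k\<close> gives
  \<open>s = (\<Sum>\<^sub>j \<surd>\<alpha>\<^sub>j / \<mu>\<^sub>j) / (\<Sum>\<^sub>j 1 / \<mu>\<^sub>j - 2)\<close>. Membership of \<open>k\<close> in the threshold set says
  \<open>\<surd>\<alpha>\<^sub>i < s\<close> off \<open>I\<^sub>k\<close>, and its minimality says \<open>\<surd>\<alpha>\<^sub>i \<ge> s\<close> on \<open>I\<^sub>k\<close>.\<close>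

text \<open>With \<open>u = 1 - 2 * m * p\<close>, \<open>v = 1 - 2 * m * q\<close> and
  \<open>b = a / (2 * m)\<close>, the payoff at \<open>p\<close> is \<open>b * (1 - 1 / u)\<close>,
  and the gap between tangent and payoff at \<open>q\<close> is exactly
  \<open>b * (u - v)\<^sup>2 / (u\<^sup>2 * v)\<close>.\<close>

lemma fractional_payoff_below_tangent:
  fixes a m p q :: real
  assumes "0 < a" "0 < m" "2 * m * p < 1" "2 * m * q < 1" "p \<noteq> q"
  shows "a * q / (2 * m * q - 1) < a * p / (2 * m * p - 1) - a / (1 - 2 * m * p)\<^sup>2 * (q - p)"
proof -
  define u v where "u = 1 - 2 * m * p" and "v = 1 - 2 * m * q"
  have pos: "u > 0" "v > 0" using assms by (auto simp: u_def v_def)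
  have "u \<noteq> v" using assms by (simp add: u_def v_def)
  define b where "b = a / (2 * m)"
  have b: "b > 0" using assms by (simp add: b_def)
  have rewr: "a * r / (2 * m * r - 1) = b * (1 - 1 / (1 - 2 * m * r))" if "2 * m * r < 1" for r
  proof -
    have "1 - 1 / (1 - 2 * m * r) = 2 * m * r / (2 * m * r - 1)"
      using that by (simp add: divide_simps) (simp add: algebra_simps)
    then show ?thesis using assms(2) by (simp add: b_def)
  qed
  have "a * (q - p) = b * (u - v)"
    using assms(2) by (simp add: b_def u_def v_def field_simps)
  then have slope: "a / u\<^sup>2 * (q - p) = b * ((u - v) / u\<^sup>2)"
    by simp
  have "1 / v - 1 / u - (u - v) / u\<^sup>2 = (u - v)\<^sup>2 / (u\<^sup>2 * v)"
    using pos by (simp add: field_simps power2_eq_square)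
  moreover have "(u - v)\<^sup>2 / (u\<^sup>2 * v) > 0" using pos \<open>u \<noteq> v\<close> by simp
  ultimately have "b * (1 - 1 / v) < b * (1 - 1 / u - (u - v) / u\<^sup>2)"
    using b by (intro mult_strict_left_mono) linarith+
  then show ?thesis
    unfolding rewr[OF assms(3)] rewr[OF assms(4)] u_def[symmetric] v_def[symmetric] slope
    by (simp add: right_diff_distrib)
qed

lemma simplex_component_le_1:
  assumes "p \<in> prob_simplex"
  shows "p $ i \<le> 1"
proof -
  have "p $ i \<le> (\<Sum>j\<in>UNIV. p $ j)"
    using assms by (intro member_le_sum) (auto simp: prob_simplex_def)
  then show ?thesis using assms by (simp add: prob_simplex_def)
qed

lemma arg_max_eq_singletonI:
  fixes f :: "'a \<Rightarrow> 'b::linorder"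
  assumes "P a" "\<And>b. P b \<Longrightarrow> b \<noteq> a \<Longrightarrow> f b < f a"
  shows "{b. is_arg_max f P b} = {a}"
  using assms unfolding is_arg_max_def by (auto dest: less_asym)

text \<open>Here \<open>- c\<close> is the multiplier of the constraint that the coordinates sum to
  1. Summing the tangent bounds over all coordinates leaves the term \<open>c\<close> times the
  difference of two coordinate sums, which vanishes on the simplex.\<close>

lemma kkt_arg_max:
  fixes m \<alpha> :: "'N::finite \<Rightarrow> real" and p :: "real ^ 'N"
  assumes p: "p \<in> prob_simplex"
    and \<alpha>: "\<And>i. \<alpha> i > 0" and m: "\<And>i. 0 < m i" "\<And>i. m i < 1 / 2"
    and kkt: "\<And>i. p $ i \<noteq> 0 \<Longrightarrow> \<alpha> i / (1 - 2 * m i * p $ i)\<^sup>2 = c"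
      "\<And>i. p $ i = 0 \<Longrightarrow> c \<le> \<alpha> i"
  shows "{p. is_arg_max (\<lambda>p. \<Sum>i\<in>UNIV. \<alpha> i * p $ i / (2 * m i * p $ i - 1))
      (\<lambda>p. p \<in> prob_simplex) p} = {p}"
proof (rule arg_max_eq_singletonI)
  show "p \<in> prob_simplex" by (fact p)
next
  fix q :: "real ^ 'N"
  assume q: "q \<in> prob_simplex" and "q \<noteq> p"
  \<comment> \<open>The pole \<open>1 / (2 * m i)\<close> lies beyond 1, hence outside the range of
    the coordinates.\<close>
  have lt: "2 * m i * r $ i < 1" if "r \<in> prob_simplex" for r i
  proof -
    have "m i * r $ i \<le> m i * 1"
      using m(1)[of i] simplex_component_le_1[OF that, of i] by (intro mult_left_mono) auto
    then show ?thesis using m(2)[of i] by simp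
  qed
  \<comment> \<open>Where \<open>p $ i = 0\<close> the slope is \<open>\<alpha> i\<close> and
    \<open>q\<close> can only move up; elsewhere the slope equals \<open>c\<close>.\<close>
  have *: "c * (q $ i - p $ i) \<le> \<alpha> i / (1 - 2 * m i * p $ i)\<^sup>2 * (q $ i - p $ i)" for i
  proof (cases "p $ i = 0")
    case True
    then show ?thesis using kkt(2)[of i] q by (auto simp: prob_simplex_def intro!: mult_right_mono)
  next
    case False
    then show ?thesis using kkt(1)[of i] by simp
  qed
  have strict: "\<alpha> i * q $ i / (2 * m i * q $ i - 1)
      < \<alpha> i * p $ i / (2 * m i * p $ i - 1) - c * (q $ i - p $ i)" if "p $ i \<noteq> q $ i" for i
    using fractional_payoff_below_tangent[OF \<alpha>[of i] m(1)[of i] lt[OF p] lt[OF q] that] *[of i]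
    by linarith
  obtain i where i: "p $ i \<noteq> q $ i" using \<open>q \<noteq> p\<close> by (metis vec_eq_iff)
  have "(\<Sum>i\<in>UNIV. \<alpha> i * q $ i / (2 * m i * q $ i - 1))
      < (\<Sum>i\<in>UNIV. \<alpha> i * p $ i / (2 * m i * p $ i - 1) - c * (q $ i - p $ i))"
  proof (rule sum_strict_mono_ex1)
    show "\<forall>i\<in>UNIV. \<alpha> i * q $ i / (2 * m i * q $ i - 1)
        \<le> \<alpha> i * p $ i / (2 * m i * p $ i - 1) - c * (q $ i - p $ i)"
    proof
      fix i
      show "\<alpha> i * q $ i / (2 * m i * q $ i - 1)
          \<le> \<alpha> i * p $ i / (2 * m i * p $ i - 1) - c * (q $ i - p $ i)"
        using strict[of i] by (cases "p $ i = q $ i") auto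
    qed
  qed (use strict[OF i] in auto)
  also have "\<dots> = (\<Sum>i\<in>UNIV. \<alpha> i * p $ i / (2 * m i * p $ i - 1))
      - c * ((\<Sum>i\<in>UNIV. q $ i) - (\<Sum>i\<in>UNIV. p $ i))"
    by (simp add: sum_subtractf sum_distrib_left right_diff_distrib)
  finally show "(\<Sum>i\<in>UNIV. \<alpha> i * q $ i / (2 * m i * q $ i - 1))
      < (\<Sum>i\<in>UNIV. \<alpha> i * p $ i / (2 * m i * p $ i - 1))"
    using p q by (simp add: prob_simplex_def)
qed

lemma compl_first_indices:
  fixes ell :: "nat \<Rightarrow> 'N::finite"
  assumes "bij_betw ell {1..CARD('N)} UNIV" "i \<le> CARD('N)"
  shows "- first_indices ell i = ell ` {i + 1..CARD('N)}"
proof -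
  have "ell ` ({1..CARD('N)} - {1..i}) = ell ` {1..CARD('N)} - ell ` {1..i}"
    using assms by (intro inj_on_image_set_diff) (auto simp: bij_betw_def)
  moreover have "{1..CARD('N)} - {1..i} = {i + 1..CARD('N)}" by auto
  ultimately show ?thesis
    using assms(1) by (simp add: first_indices_def bij_betw_def Compl_eq_Diff_UNIV)
qed

text \<open>Consecutive tails differ in one index; this rewrites the failed test at
  \<open>k - 1\<close> in terms of the sums at \<open>k\<close>.\<close>

lemma sum_compl_first_indices_Suc:
  fixes ell :: "nat \<Rightarrow> 'N::finite" and g :: "'N \<Rightarrow> real"
  assumes "bij_betw ell {1..CARD('N)} UNIV" "i < CARD('N)"
  shows "sum g (- first_indices ell i) = g (ell (Suc i)) + sum g (- first_indices ell (Suc i))"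
proof -
  have "{i + 1..CARD('N)} = insert (Suc i) {Suc i + 1..CARD('N)}" using assms(2) by auto
  moreover have "ell (Suc i) \<notin> ell ` {Suc i + 1..CARD('N)}"
    using assms by (subst inj_on_image_mem_iff[where B = "{1..CARD('N)}"]) (auto simp: bij_betw_def)
  ultimately show ?thesis
    using assms by (simp add: compl_first_indices)
qed

text \<open>Only one index \<open>l\<close> is left outside, and the test
  \<open>(1 / m l - 2) * sqrt (\<alpha> l) < sqrt (\<alpha> l) / m l\<close> reduces to
  \<open>0 < 2 * sqrt (\<alpha> l)\<close>.\<close>

lemma threshold_set_last:
  fixes ell :: "nat \<Rightarrow> 'N::finite"
  assumes "bij_betw ell {1..CARD('N)} UNIV" "\<And>i. \<alpha> i > 0"
  shows "CARD('N) - 1 \<in> threshold_set ell \<alpha> m"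
proof -
  have N: "CARD('N) > 0" by simp
  then have "{CARD('N) - 1 + 1..CARD('N)} = {CARD('N)}" by auto
  then have "- first_indices ell (CARD('N) - 1) = {ell (CARD('N))}"
    using compl_first_indices[OF assms(1), of "CARD('N) - 1"] by simp
  then show ?thesis
    using N assms(2)[of "ell (CARD('N))"]
    by (simp add: threshold_set_def algebra_simps)
qed

theorem proposition2p4:
  fixes \<omega> :: "'N::finite \<Rightarrow> real"
    and x :: "'N \<Rightarrow> real ^ 'n::finite"
    and \<rho> \<mu> :: real
    and \<mu>s \<alpha> :: "'N \<Rightarrow> real"
    and ell :: "nat \<Rightarrow> 'N"
    and k :: nat
    and pbar :: "real ^ 'N"
  assumes "\<And>i. \<omega> i > 0"
    and "\<rho> = 2 * Max (range \<omega>)"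
    and "0 < \<mu>" and "\<mu> < 1 / \<rho>"
    and "\<And>i. \<mu>s i = \<mu> * \<omega> i"
    and "\<And>i. \<alpha> i = \<omega> i * (norm (x i))\<^sup>2"
    and "\<And>i. \<alpha> i > 0"
    and "bij_betw ell {1..CARD('N)} UNIV"
    and "antimono_on {1..CARD('N)} (\<lambda>i. \<alpha> (ell i))"
    and "k = Min (threshold_set ell \<alpha> \<mu>s)"
    and "pbar = (\<chi> i.
          if i \<in> first_indices ell k then 0
          else 1 / (2 * \<mu>s i) *
            (1 - ((\<Sum>j\<in>- first_indices ell k. 1 / \<mu>s j) - 2) * sqrt (\<alpha> i)
                   / (\<Sum>j\<in>- first_indices ell k. sqrt (\<alpha> j) / \<mu>s j)))"
  shows "threshold_set ell \<alpha> \<mu>s \<noteq> {} \<and>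
    {p. is_arg_max (\<lambda>p. \<Sum>i\<in>UNIV. \<alpha> i * p $ i / (2 * \<mu>s i * p $ i - 1))
          (\<lambda>p. p \<in> prob_simplex) p} = {pbar}"
proof -
  let ?I = "first_indices ell k"
  define A B where "A = (\<Sum>j\<in>-?I. 1 / \<mu>s j)" and "B = (\<Sum>j\<in>-?I. sqrt (\<alpha> j) / \<mu>s j)"
  note bij = assms(8)
  have \<alpha>: "\<alpha> i > 0" for i by fact
  have m0: "\<mu>s i > 0" for i using assms(1,3,5) by simp
  have m1: "\<mu>s i < 1 / 2" for i
  proof -
    have le: "\<omega> i \<le> Max (range \<omega>)" by simp
    \<comment> \<open>This makes \<rho> positive, so that \<mu> < 1 / \<rho> can be cleared of its
      denominator.\<close>
    then have "Max (range \<omega>) > 0" using assms(1)[of i] by linarith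
    then have "\<mu> * (2 * Max (range \<omega>)) < 1"
      using assms(2,4) by (simp add: field_simps)
    moreover have "\<mu> * \<omega> i \<le> \<mu> * Max (range \<omega>)"
      using le assms(3) by (intro mult_left_mono) auto
    ultimately show ?thesis using assms(5)[of i] by simp
  qed
  \<comment> \<open>\<open>Min\<close> is informative only on a nonempty finite set, so this makes
    \<open>k\<close> a genuine minimum.\<close>
  have ne: "threshold_set ell \<alpha> \<mu>s \<noteq> {}"
    using threshold_set_last[OF bij, of \<alpha> \<mu>s] \<alpha> by blast
  have fin: "finite (threshold_set ell \<alpha> \<mu>s)" by (simp add: threshold_set_def)
  have k: "k \<in> threshold_set ell \<alpha> \<mu>s" using Min_in[OF fin ne] assms(10) by simp
  have kN: "k < CARD('N)"
  proof -
    have "k \<le> CARD('N) - 1" using k by (simp add: threshold_set_def)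
    moreover have "CARD('N) > 0" by simp
    ultimately show ?thesis by linarith
  qed
  have below: "\<not> j < k" if "j \<in> threshold_set ell \<alpha> \<mu>s" for j
    using Min_le[OF fin that] assms(10) by simp
  have anti: "\<alpha> (ell j) \<le> \<alpha> (ell i)" if "1 \<le> i" "i \<le> j" "j \<le> CARD('N)" for i j
    using monotone_onD[OF assms(9), of i j] that by simp
  have comp: "-?I = ell ` {k + 1..CARD('N)}"
    using compl_first_indices[OF bij] kN by simp
  have mem: "ell (k + 1) \<in> -?I" using kN unfolding comp by auto
  \<comment> \<open>A single term of \<open>A\<close> already exceeds 2, so dividing by
    \<open>A - 2\<close> preserves inequalities.\<close>
  have "1 / \<mu>s (ell (k + 1)) \<le> A"
    unfolding A_def using mem m0 by (intro member_le_sum) (auto intro: less_imp_le)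
  moreover have "2 < 1 / \<mu>s (ell (k + 1))"
    using m0[of "ell (k + 1)"] m1[of "ell (k + 1)"] by (simp add: field_simps)
  ultimately have A: "A > 2" by simp
  have B: "B > 0"
    unfolding B_def using mem m0 \<alpha> by (intro sum_pos) auto
  define s where "s = B / (A - 2)"
  have s: "s > 0" using A B by (simp add: s_def)
  have off: "sqrt (\<alpha> i) < s" if "i \<notin> ?I" for i
  proof -
    have "i \<in> ell ` {k + 1..CARD('N)}" using that unfolding comp[symmetric] by simp
    then obtain j where j: "i = ell j" "k + 1 \<le> j" "j \<le> CARD('N)" by auto
    \<comment> \<open>By the ordering, \<open>ell (k + 1)\<close> carries the largest \<alpha>
      outside \<open>?I\<close>, so the test at that index covers all the others.\<close>
    have "sqrt (\<alpha> i) \<le> sqrt (\<alpha> (ell (k + 1)))" using anti[of "k + 1" j] j by simp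
    also have "\<dots> < s"
    proof -
      have "(A - 2) * sqrt (\<alpha> (ell (k + 1))) < B"
        using k by (simp add: threshold_set_def A_def B_def)
      then show ?thesis using A by (simp add: s_def pos_less_divide_eq mult.commute)
    qed
    finally show ?thesis .
  qed
  have on: "s \<le> sqrt (\<alpha> i)" if i: "i \<in> ?I" for i
  proof -
    obtain j where j: "i = ell j" "1 \<le> j" "j \<le> k"
      using i by (auto simp: first_indices_def)
    \<comment> \<open>As \<open>?I\<close> is nonempty, \<open>k\<close> is a successor. Its
      predecessor is in range, so by minimality it must fail the inequality itself.\<close>
    define r where "r = k - 1"
    have r: "k = Suc r" "r < CARD('N)" using j kN by (auto simp: r_def)
    have "r \<notin> threshold_set ell \<alpha> \<mu>s" using below[of r] r by auto
    then have "(\<Sum>j\<in>-first_indices ell r. sqrt (\<alpha> j) / \<mu>s j)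
        \<le> ((\<Sum>j\<in>-first_indices ell r. 1 / \<mu>s j) - 2) * sqrt (\<alpha> (ell k))"
      using r by (auto simp: threshold_set_def)
    \<comment> \<open>The index \<open>ell k\<close> contributes
      \<open>sqrt (\<alpha> (ell k)) / \<mu>s (ell k)\<close> to both sides, and these terms
      cancel.\<close>
    then have "B \<le> (A - 2) * sqrt (\<alpha> (ell k))"
      unfolding A_def B_def r(1) sum_compl_first_indices_Suc[OF bij r(2)]
      by (simp add: algebra_simps)
    then have "s \<le> sqrt (\<alpha> (ell k))" using A by (simp add: s_def pos_divide_le_eq mult.commute)
    also have "\<dots> \<le> sqrt (\<alpha> i)" using anti[of j k] j kN by simp
    finally show ?thesis .
  qed
  have pI: "pbar $ i = 0" if "i \<in> ?I" for i using that assms(11) by simp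
  have p: "pbar $ i = 1 / (2 * \<mu>s i) * (1 - sqrt (\<alpha> i) / s)" if "i \<notin> ?I" for i
    using that assms(11) by (simp add: A_def B_def s_def)
  \<comment> \<open>Strictness serves twice: for membership in the simplex, and to conclude that
    zero coordinates occur only in \<open>?I\<close>.\<close>
  have ppos: "pbar $ i > 0" if "i \<notin> ?I" for i
    unfolding p[OF that] using off[OF that] m0[of i] s by simp
  have "(\<Sum>i\<in>UNIV. pbar $ i) = (\<Sum>i\<in>-?I. pbar $ i)"
    by (rule sum.mono_neutral_right) (auto simp: pI)
  also have "\<dots> = (\<Sum>i\<in>-?I. (1 / \<mu>s i - sqrt (\<alpha> i) / \<mu>s i / s) / 2)"
    by (rule sum.cong) (simp_all add: p diff_divide_distrib right_diff_distrib)
  also have "\<dots> = (A - B / s) / 2"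
    by (simp only: A_def B_def sum_subtractf flip: sum_divide_distrib)
  \<comment> \<open>The choice of \<open>s\<close> gives \<open>B / s = A - 2\<close>.\<close>
  also have "\<dots> = 1" using A B by (simp add: s_def)
  finally have "(\<Sum>i\<in>UNIV. pbar $ i) = 1" .
  have simplex: "pbar \<in> prob_simplex"
  proof -
    have "0 \<le> pbar $ i" for i
      using pI[of i] ppos[of i] by (cases "i \<in> ?I") auto
    with \<open>(\<Sum>i\<in>UNIV. pbar $ i) = 1\<close> show ?thesis by (simp add: prob_simplex_def)
  qed
  have "{p. is_arg_max (\<lambda>p. \<Sum>i\<in>UNIV. \<alpha> i * p $ i / (2 * \<mu>s i * p $ i - 1))
          (\<lambda>p. p \<in> prob_simplex) p} = {pbar}"
  proof (rule kkt_arg_max[OF simplex, where c = "s\<^sup>2"])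
    show "\<alpha> i > 0" "0 < \<mu>s i" "\<mu>s i < 1 / 2" for i by (fact \<alpha> m0 m1)+
  next
    fix i assume "pbar $ i \<noteq> 0"
    then have "i \<notin> ?I" using pI by blast
    from p[OF this] have "1 - 2 * \<mu>s i * pbar $ i = sqrt (\<alpha> i) / s"
      using m0[of i] by simp
    then show "\<alpha> i / (1 - 2 * \<mu>s i * pbar $ i)\<^sup>2 = s\<^sup>2"
      using \<alpha>[of i] s by (simp add: power_divide)
  next
    fix i assume "pbar $ i = 0"
    then have "i \<in> ?I" using ppos[of i] by (metis less_irrefl)
    then show "s\<^sup>2 \<le> \<alpha> i"
      using on[of i] s \<alpha>[of i] power_mono[of s "sqrt (\<alpha> i)" 2] by simp
  qed
  with ne show ?thesis by blast
qed

end
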